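(* Let $n\ge 1$ and let $H=[h_{i,j}]_{1\le i,j\le n}$ be a matrix of nonnegative integers such that $h_{i,i}=a_i$ for $i\in[n]$ and $h_{i,j}=b$ for all $i\neq j$, where $a_i\ge b$ for each $i\in[n]$. Then \[\dim_{\mathbb{K}}\left(R_n/\mathcal{J}_H\right)=\det H.\]
   Context: $\mathbb{K}$ is a field and $R_n=\mathbb{K}[x_1,\ldots,x_n]$. For a symmetric $n\times n$ matrix $H=[h_{i,j}]$ of nonnegative integers with $h_{i,i}\ge \max_{j\ne i}h_{i,j}$ for all $i$, write $\alpha_i=h_{i,i}$ and define the monomial ideal $\mathcal{J}_H=\left\langle x_t^{\alpha_t},\ x_i^{\alpha_i-h_{i,j}}x_j^{\alpha_j-h_{i,j}} \mid 1\le t\le n,\ 1\le i<j\le n\right\rangle\subseteq R_n$. *)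

theory Defs
  imports
    "HOL-Analysis.Determinants"
    "HOL-Library.Poly_Mapping"
    "HOL-Algebra.QuotRing"
    "Jordan_Normal_Form.Missing_VectorSpace"
begin

text \<open>
  The index set $[n]$ is a finite linearly ordered type \<open>'n\<close> (so $n$ is \<open>CARD('n)\<close>, and
  $n \geq 1$ because types are nonempty). Exponent vectors are \<open>'n \<Rightarrow>\<^sub>0 nat\<close>, and $R_n$ is the type
  of finitely supported coefficient functions on them, with the convolution product
  of \<open>HOL-Library.Poly_Mapping\<close>.
\<close>

type_synonym ('n, 'k) mpoly = "('n \<Rightarrow>\<^sub>0 nat) \<Rightarrow>\<^sub>0 'k"

definition Var :: "'n \<Rightarrow> ('n, 'k::comm_ring_1) mpoly" where
  "Var i = Poly_Mapping.single (Poly_Mapping.single i 1) 1"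

definition Const :: "'k::comm_ring_1 \<Rightarrow> ('n, 'k) mpoly" where
  "Const c = Poly_Mapping.single 0 c"

text \<open>
  Ideals, quotient rings and vector spaces are taken from the carrier-based libraries;
  \<open>type_ring\<close> is a type-class ring viewed as such a structure. It is used both for
  $\mathbb{K}$ and for $R_n$.
\<close>

definition type_ring :: "'a::comm_ring_1 ring" where
  "type_ring = \<lparr>carrier = UNIV, mult = (*), one = 1, zero = 0, add = (+)\<rparr>"

text \<open>
  The exponents use truncated subtraction; it agrees with subtraction of integers under the
  standing assumption $h_{i,i} \geq h_{i,j}$.
\<close>

definition J_ideal :: "nat ^ 'n::{finite,linorder} ^ 'n::{finite,linorder}
    \<Rightarrow> ('n, 'k::field) mpoly set" where
  "J_ideal H = genideal type_ring
     ({Var t ^ (H $ t $ t) | t. True} \<union>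
      {Var i ^ (H $ i $ i - H $ i $ j) * Var j ^ (H $ j $ j - H $ i $ j) | i j. i < j})"

text \<open>
  The quotient ring $R_n/J$ with the $\mathbb{K}$-action through
  $\mathbb{K} \to R_n \to R_n/J$.
\<close>

definition quotient_algebra ::
    "('n, 'k::field) mpoly set \<Rightarrow> ('k, ('n, 'k) mpoly set) module" where
  "quotient_algebra J =
     ring.extend (type_ring Quot J)
       (module.fields (\<lambda>c X. (J +>\<^bsub>type_ring\<^esub> Const c) \<otimes>\<^bsub>type_ring Quot J\<^esub> X))"

lemma cring_type_ring: "cring (type_ring :: 'a::comm_ring_1 ring)"
proof (rule cringI)
  show "abelian_group (type_ring :: 'a ring)"
    by (rule abelian_groupI) (auto simp: type_ring_def algebra_simps intro: exI[of _ "- _"] left_minus)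
  show "Group.comm_monoid (type_ring :: 'a ring)"
    by (rule Group.comm_monoidI) (auto simp: type_ring_def algebra_simps)
qed (auto simp: type_ring_def algebra_simps)

lemma field_type_ring: "field (type_ring :: 'k::field ring)"
proof -
  interpret cring "type_ring :: 'k ring" by (rule cring_type_ring)
  show ?thesis
  proof (rule cring_fieldI)
    have "x \<in> Units type_ring \<longleftrightarrow> x \<noteq> 0" for x :: 'k
      unfolding Units_def
      by (auto simp: type_ring_def intro!: exI[of _ "inverse x"])
    then show "Units (type_ring :: 'k ring) = carrier type_ring - {\<zero>\<^bsub>type_ring\<^esub>}"
      by (auto simp: type_ring_def)
  qed
qed

lemma Const_ring_hom: "Const \<in> ring_hom type_ring type_ring"
  by (rule ring_hom_memI)
     (auto simp: type_ring_def Const_def mult_single single_add)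

lemma vectorspace_quotient_algebra:
  fixes J :: "('n, 'k::field) mpoly set"
  assumes "ideal J type_ring"
  shows "vectorspace type_ring (quotient_algebra J)"
proof -
  let ?R = "type_ring :: ('n, 'k) mpoly ring" and ?K = "type_ring :: 'k ring"
  let ?Q = "?R Quot J"
  interpret ideal J ?R by (rule assms)
  interpret Q: cring ?Q by (rule quotient_is_cring[OF cring_type_ring])
  define h :: "'k \<Rightarrow> ('n, 'k) mpoly set" where "h c = J +>\<^bsub>?R\<^esub> Const c" for c
  have "(+>\<^bsub>?R\<^esub>) J \<circ> Const \<in> ring_hom ?K ?Q"
    by (rule ring_hom_trans[OF Const_ring_hom rcos_ring_hom])
  then have h: "h \<in> ring_hom ?K ?Q"
    by (simp add: h_def[abs_def] comp_def)
  have sel: "carrier (quotient_algebra J) = carrier ?Q"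
       "mult (quotient_algebra J) = mult ?Q" "one (quotient_algebra J) = one ?Q"
       "zero (quotient_algebra J) = zero ?Q" "add (quotient_algebra J) = add ?Q"
       "smult (quotient_algebra J) = (\<lambda>c X. h c \<otimes>\<^bsub>?Q\<^esub> X)"
    by (simp_all add: quotient_algebra_def h_def ring.defs module.defs)
  have ab: "abelian_group (quotient_algebra J)"
    by (rule abelian_groupI)
       (auto simp: sel Q.a_ac intro: Q.l_neg bexI[of _ "\<ominus>\<^bsub>?Q\<^esub> _"])
  have "module ?K (quotient_algebra J)"
    by (rule moduleI[OF cring_type_ring ab])
       (auto simp: sel ring_hom_closed[OF h] ring_hom_add[OF h] ring_hom_mult[OF h]
          ring_hom_one[OF h] Q.l_distr Q.r_distr Q.m_assoc)
  then show ?thesis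
    using field_type_ring by (rule vectorspace.intro)
qed

lemma ideal_J_ideal:
  "ideal (J_ideal H :: ('n::{finite,linorder}, 'k::field) mpoly set) type_ring"
proof -
  interpret cring "type_ring :: ('n, 'k) mpoly ring" by (rule cring_type_ring)
  show ?thesis
    unfolding J_ideal_def by (rule genideal_ideal) (simp add: type_ring_def)
qed

end

theory Submission
  imports Defs
begin

text \<open>
  Put $c_i = a_i - b$. The monomials outside the monomial ideal $\mathcal{J}_H$ form a basis of the
  quotient; they are the $x^m$ with $m_i < c_i + b$ for all $i$ and $m_i \geq c_i$ for at most one
  $i$. Sorting them by that exceptional index gives
  $\prod_i c_i + b \sum_k \prod_{i \neq k} c_i$ of them, and this is also the determinant of
  $H = \mathrm{diag}(c) + b\,\mathbf{1}\mathbf{1}^T$, as one sees by adding the constant $b$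
  to the rows of $\mathrm{diag}(c)$ one at a time, using linearity of the determinant in that row.
\<close>

section \<open>The determinant of a diagonal matrix plus a constant matrix\<close>

text \<open>In the Leibniz expansion only the identity survives: a permutation fixing every index
  other than \<open>k\<close> also fixes \<open>k\<close>, so any other permutation meets an
  off-diagonal zero in a row different from \<open>k\<close>.\<close>

lemma det_diagonal_replace_row:
  fixes c v :: "'n::finite \<Rightarrow> 'a::comm_ring_1"
  shows "det (\<chi> i j. if i = k then v j else if i = j then c i else 0) = v k * prod c (UNIV - {k})"
proof -
  let ?A = "\<chi> i j. if i = k then v j else if i = j then c i else 0"
  have "(\<Prod>i\<in>UNIV. ?A $ i $ p i) = 0" if p: "p permutes (UNIV :: 'n set)" and "p \<noteq> id" for p
  proof -
    have "\<exists>i. i \<noteq> k \<and> p i \<noteq> i"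
    proof (rule ccontr)
      assume "\<not> ?thesis"
      then have fix_off: "p i = i" if "i \<noteq> k" for i
        using that by blast
      then have "p k = k"
        by (metis p permutes_def)
      with fix_off have "p = id"
        by fastforce
      with \<open>p \<noteq> id\<close> show False ..
    qed
    then obtain i where "i \<noteq> k" "p i \<noteq> i" by blast
    then have "?A $ i $ p i = 0" by auto
    then show ?thesis
      by (intro prod_zero bexI[of _ i]) simp_all
  qed
  then have "det ?A = (\<Sum>p\<in>{id}. of_int (sign p) * (\<Prod>i\<in>UNIV. ?A $ i $ p i))"
    unfolding det_def
    by (intro sum.mono_neutral_right finite_permutations finite) (simp_all add: permutes_id)
  also have "\<dots> = (\<Prod>i\<in>UNIV. ?A $ i $ i)" by (simp add: sign_id)
  also have "\<dots> = v k * (\<Prod>i\<in>UNIV - {k}. ?A $ i $ i)"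
    by (subst prod.remove[of _ k]) auto
  also have "(\<Prod>i\<in>UNIV - {k}. ?A $ i $ i) = prod c (UNIV - {k})"
    by (rule prod.cong) auto
  finally show ?thesis .
qed

text \<open>Row \<open>k\<close> consists of ones, so adding \<open>b\<close> times it to another
  row installs the constant there without changing the determinant. Since \<open>k\<close> is not in
  \<open>S\<close>, these operations never touch row \<open>k\<close> itself.\<close>

lemma det_diagonal_plus_const_rows_one_row:
  fixes c :: "'n::finite \<Rightarrow> 'a::comm_ring_1"
  assumes "k \<notin> S"
  shows "det (\<chi> i j. if i = k then 1 else (if i = j then c i else 0) + (if i \<in> S then b else 0))
    = prod c (UNIV - {k})"
proof -
  have "finite S" by simp
  then show ?thesis using assms
  proof (induction S)
    case empty
    show ?case using det_diagonal_replace_row[of k "\<lambda>_. 1" c] by (simp cong: if_cong)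
  next
    case (insert x S)
    let ?A = "\<lambda>S. (\<chi> i j. if i = k then 1 else (if i = j then c i else 0) + (if i \<in> S then b else 0)) :: 'a^'n^'n"
    have row_op: "?A (insert x S)
        = (\<chi> i. if i = x then row x (?A S) + b *s row k (?A S) else row i (?A S))"
      using insert by (auto simp: vec_eq_iff row_def)
    have "det (?A (insert x S)) = det (?A S)"
      unfolding row_op using insert.prems by (intro det_row_operation) auto
    moreover have "det (?A S) = prod c (UNIV - {k})"
      using insert.prems by (intro insert.IH) simp
    ultimately show ?case by (rule trans)
  qed
qed

text \<open>Allowing any set \<open>S\<close> of rows makes induction possible: linearity in the new
  row \<open>x\<close> splits off \<open>b\<close> times a determinant with a row of ones, which the
  previous lemma evaluates. The theorem takes \<open>S\<close> to be all of
  \<open>UNIV\<close>.\<close>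

lemma det_diagonal_plus_const_rows:
  fixes c :: "'n::finite \<Rightarrow> 'a::comm_ring_1"
  shows "det (\<chi> i j. (if i = j then c i else 0) + (if i \<in> S then b else 0))
    = prod c UNIV + b * (\<Sum>k\<in>S. prod c (UNIV - {k}))"
proof -
  have "finite S" by simp
  then show ?thesis
  proof (induction S)
    case empty
    show ?case by (subst det_diagonal) auto
  next
    case (insert x S)
    let ?r = "\<lambda>S i. (\<chi> j. (if i = j then c i else 0) + (if i \<in> S then b else 0)) :: 'a^'n"
    have "(\<chi> i j. (if i = j then c i else 0) + (if i \<in> insert x S then b else 0))
        = (\<chi> i. if i = x then ?r S i + b *s 1 else ?r S i)"
      using insert by (auto simp: vec_eq_iff)
    \<comment> \<open>This equation and the next identify the two matrices produced by splitting row
      \<open>x\<close>: one with the old row back in place, one with the row of ones left after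
      \<open>b\<close> is pulled out.\<close>
    moreover have "(\<chi> i. if i = x then ?r S i else ?r S i) = (\<chi> i. ?r S i)"
      by simp
    moreover have "(\<chi> i. if i = x then 1 else ?r S i)
       = (\<chi> i j. if i = x then 1 else (if i = j then c i else 0) + (if i \<in> S then b else 0))"
      by (auto simp: vec_eq_iff)
    ultimately have "det (\<chi> i j. (if i = j then c i else 0) + (if i \<in> insert x S then b else 0))
      = det (\<chi> i. ?r S i) + b * prod c (UNIV - {x})"
      using insert by (simp only: det_row_add det_row_mul det_diagonal_plus_const_rows_one_row simp_thms)
    with insert show ?case by (simp add: algebra_simps)
  qed
qed

section \<open>Counting the exponent vectors outside the ideal\<close>

text \<open>The set splits into disjoint boxes according to which coordinate, if any, reaches its
  threshold \<open>c k\<close>. Each summand of the formula is the size of one box.\<close>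

lemma card_box_at_most_one_large:
  fixes c :: "'n::finite \<Rightarrow> nat" and b :: nat
  defines "F \<equiv> {f. (\<forall>i. f i < c i + b) \<and> (\<forall>i j. i \<noteq> j \<longrightarrow> \<not> (c i \<le> f i \<and> c j \<le> f j))}"
  shows "finite F" and "card F = prod c UNIV + b * (\<Sum>k\<in>UNIV. prod c (UNIV - {k}))"
proof -
  \<comment> \<open>\<open>L k\<close> is the box where \<open>k\<close> alone reaches its
    threshold: coordinate \<open>k\<close> has \<open>b\<close> possible values, every other
    coordinate \<open>i\<close> has \<open>c i\<close>. In \<open>?B\<close> no coordinate
    does.\<close>
  define L where "L k = PiE UNIV (\<lambda>i. if i = k then {c k..<c k + b} else {..<c i})" for k
  let ?B = "PiE UNIV (\<lambda>i. {..<c i})"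
  have L: "f \<in> L k \<longleftrightarrow> c k \<le> f k \<and> f k < c k + b \<and> (\<forall>i. i \<noteq> k \<longrightarrow> f i < c i)" for f k
    by (simp add: L_def PiE_UNIV_domain Pi_iff if_distrib[of "\<lambda>S. _ \<in> S"] all_conj_distrib imp_conjL cong: if_cong)
  have B: "f \<in> ?B \<longleftrightarrow> (\<forall>i. f i < c i)" for f
    by (auto simp: PiE_UNIV_domain Pi_iff)
  have F: "F = ?B \<union> (\<Union>k. L k)"
  proof (intro equalityI subsetI)
    fix f assume f: "f \<in> F"
    show "f \<in> ?B \<union> (\<Union>k. L k)"
    proof (cases "\<exists>k. c k \<le> f k")
      case True
      then obtain k where k: "c k \<le> f k" ..
      have small: "f i < c i" if "i \<noteq> k" for i
        using f k that by (auto simp: F_def not_le[symmetric])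
      have "f k < c k + b"
        using f by (simp add: F_def)
      with k small have "f \<in> L k"
        by (simp add: L)
      then show ?thesis by (rule UnI2[OF UN_I[OF UNIV_I]])
    next
      case False
      then show ?thesis by (simp add: B not_le)
    qed
  next
    fix f assume "f \<in> ?B \<union> (\<Union>k. L k)"
    then consider "\<forall>i. f i < c i" | k where "f \<in> L k" unfolding B[symmetric] by blast
    then show "f \<in> F"
    proof cases
      case 1
      then show ?thesis
        unfolding F_def by (simp add: not_le trans_less_add1)
    next
      case 2
      then have large: "f k < c k + b" and small: "\<And>i. i \<noteq> k \<Longrightarrow> f i < c i"
        by (simp_all add: L)
      have "f i < c i + b" for i
        using large small[of i] by (cases "i = k") auto
      moreover have "f i < c i \<or> f j < c j" if "i \<noteq> j" for i j
        using small[of i] small[of j] that by (cases "i = k") auto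
      ultimately show ?thesis
        by (simp add: F_def not_le[symmetric])
    qed
  qed
  have fin: "finite ?B" "\<And>k. finite (L k)"
    unfolding L_def by (auto intro!: finite_PiE)
  then show "finite F"
    unfolding F by auto
  have disj: "L k \<inter> L l = {}" if "k \<noteq> l" for k l
  proof -
    have False if "f \<in> L k" "f \<in> L l" for f
    proof -
      have "f l < c l" "c l \<le> f l" using that \<open>k \<noteq> l\<close> by (simp_all add: L)
      then show False by simp
    qed
    then show ?thesis by blast
  qed
  have disjB: "?B \<inter> (\<Union>k. L k) = {}"
  proof -
    have False if "f \<in> ?B" "f \<in> L k" for f k
    proof -
      have "f k < c k" "c k \<le> f k" using that unfolding B L by blast+
      then show False by simp
    qed
    then show ?thesis by blast
  qed
  have cardL: "card (L k) = b * prod c (UNIV - {k})" for k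
  proof -
    have "card (L k) = (\<Prod>i\<in>UNIV. if i = k then b else c i)"
      unfolding L_def by (subst card_PiE) (auto intro!: prod.cong)
    also have "\<dots> = b * prod c (UNIV - {k})"
      by (subst prod.remove[of _ k]) (auto intro!: prod.cong)
    finally show ?thesis .
  qed
  have "card F = card ?B + (\<Sum>k\<in>UNIV. card (L k))"
    unfolding F using fin disj disjB by (subst card_Un_disjoint) (auto simp: card_UN_disjoint)
  then show "card F = prod c UNIV + b * (\<Sum>k\<in>UNIV. prod c (UNIV - {k}))"
    by (simp add: card_PiE cardL sum_distrib_left)
qed

section \<open>Monomial ideals described by supports\<close>

text \<open>Every exponent of a product is a sum of exponents of the factors, so closure of
  \<open>U\<close> under addition of arbitrary exponents absorbs multiplication.\<close>

lemma keys_subset_ideal: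
  fixes U :: "'m::comm_monoid_add set"
  assumes up: "\<And>k d. k \<in> U \<Longrightarrow> k + d \<in> U"
  shows "ideal {p :: 'm \<Rightarrow>\<^sub>0 'k::comm_ring_1. Poly_Mapping.keys p \<subseteq> U} type_ring"
proof -
  interpret cring "type_ring :: ('m \<Rightarrow>\<^sub>0 'k) ring" by (rule cring_type_ring)
  let ?I = "{p :: 'm \<Rightarrow>\<^sub>0 'k. Poly_Mapping.keys p \<subseteq> U}"
  have mult: "a * x \<in> ?I" if "a \<in> ?I" for a x
    using keys_mult[of a x] that up by blast
  show ?thesis
  proof (rule idealI)
    show "ring (type_ring :: ('m \<Rightarrow>\<^sub>0 'k) ring)" by (rule ring_axioms)
    show "subgroup ?I (add_monoid type_ring)"
    proof (rule subgroup.intro)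
      fix a assume "a \<in> ?I"
      moreover have "\<ominus>\<^bsub>type_ring\<^esub> a = - a"
        by (rule minus_equality) (auto simp: type_ring_def)
      ultimately show "inv\<^bsub>add_monoid type_ring\<^esub> a \<in> ?I"
        by (simp add: a_inv_def)
    next
      fix a b assume "a \<in> ?I" "b \<in> ?I"
      then show "a \<otimes>\<^bsub>add_monoid type_ring\<^esub> b \<in> ?I"
        using Poly_Mapping.keys_add[of a b] by (auto simp: type_ring_def)
    qed (simp_all add: type_ring_def)
  qed (use mult in \<open>auto simp: type_ring_def mult.commute\<close>)
qed

lemma ideal_sum_closed:
  assumes "ideal I (type_ring :: 'a::comm_ring_1 ring)" and "\<And>i. i \<in> A \<Longrightarrow> f i \<in> I"
  shows "sum f A \<in> I"
proof -
  interpret ideal I "type_ring :: 'a ring" by fact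
  have "0 \<in> I" "\<And>x y. x \<in> I \<Longrightarrow> y \<in> I \<Longrightarrow> x + y \<in> I"
    using additive_subgroup.zero_closed[OF additive_subgroup_axioms]
      additive_subgroup.a_closed[OF additive_subgroup_axioms] by (simp_all add: type_ring_def)
  with assms(2) show ?thesis
    by (induction A rule: infinite_finite_induct) auto
qed

lemma poly_mapping_sum_single:
  fixes p :: "'m \<Rightarrow>\<^sub>0 'k::comm_monoid_add"
  shows "(\<Sum>k\<in>Poly_Mapping.keys p. Poly_Mapping.single k (Poly_Mapping.lookup p k)) = p"
  by (rule poly_mapping_eqI)
     (auto simp: lookup_sum lookup_single when_def in_keys_iff)

text \<open>One inclusion is minimality of the generated ideal, as the right-hand side is an ideal
  containing the generators. For the other, a polynomial is the sum of its terms, and each term is a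
  multiple of a generator.\<close>

lemma genideal_monomials:
  fixes M :: "'m::comm_monoid_add set"
  shows "genideal type_ring ((\<lambda>m. Poly_Mapping.single m (1::'k::comm_ring_1)) ` M)
    = {p. Poly_Mapping.keys p \<subseteq> {m + d | m d. m \<in> M}}" (is "genideal _ ?G = ?I")
proof (rule antisym)
  interpret cring "type_ring :: ('m \<Rightarrow>\<^sub>0 'k) ring" by (rule cring_type_ring)
  have car: "?G \<subseteq> carrier type_ring" by (simp add: type_ring_def)
  have "ideal ?I type_ring"
    by (rule keys_subset_ideal) (use add.assoc in blast)
  moreover have "?G \<subseteq> ?I"
    by (force intro: exI[of _ 0])
  ultimately show "genideal type_ring ?G \<subseteq> ?I"
    by (rule genideal_minimal)
  have I: "ideal (genideal type_ring ?G) type_ring"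
    using car by (rule genideal_ideal)
  show "?I \<subseteq> genideal type_ring ?G"
  proof
    fix p assume p: "p \<in> ?I"
    have "Poly_Mapping.single k (Poly_Mapping.lookup p k) \<in> genideal type_ring ?G"
      if k: "k \<in> Poly_Mapping.keys p" for k
    proof -
      obtain m d where md: "k = m + d" "m \<in> M" using p k by blast
      have "Poly_Mapping.single m 1 \<in> genideal type_ring ?G"
        using genideal_self[OF car] md by blast
      from ideal.I_r_closed[OF I this, of "Poly_Mapping.single d (Poly_Mapping.lookup p k)"]
      show ?thesis by (simp add: type_ring_def mult_single md)
    qed
    then have "(\<Sum>k\<in>Poly_Mapping.keys p. Poly_Mapping.single k (Poly_Mapping.lookup p k))
        \<in> genideal type_ring ?G"
      by (rule ideal_sum_closed[OF I])
    then show "p \<in> genideal type_ring ?G"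
      by (simp add: poly_mapping_sum_single)
  qed
qed

section \<open>The monomial basis of the quotient\<close>

text \<open>A coset of \<open>J\<close> is determined by its coefficients outside \<open>U\<close>,
  and these can be prescribed freely; hence the classes of the monomials outside \<open>U\<close>
  form a basis.\<close>

lemma monomial_quotient_dim:
  fixes U :: "('n \<Rightarrow>\<^sub>0 nat) set"
  defines "J \<equiv> {p :: ('n, 'k::field) mpoly. Poly_Mapping.keys p \<subseteq> U}"
  assumes J: "ideal J type_ring" and fin: "finite (- U)"
  shows "vectorspace.fin_dim type_ring (quotient_algebra J)"
    and "vectorspace.dim type_ring (quotient_algebra J) = card (- U)"
proof -
  let ?R = "type_ring :: ('n, 'k) mpoly ring" and ?K = "type_ring :: 'k ring"
  let ?V = "quotient_algebra J"
  interpret J: ideal J ?R by (rule J)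
  interpret V: vectorspace ?K ?V by (rule vectorspace_quotient_algebra[OF J])
  define h :: "('n, 'k) mpoly \<Rightarrow> ('n, 'k) mpoly set" where "h p = J +>\<^bsub>?R\<^esub> p" for p
  have R_sel: "carrier ?R = UNIV" "add ?R = (+)" "mult ?R = (*)" "zero ?R = 0"
    by (simp_all add: type_ring_def)
  have K_sel: "carrier ?K = UNIV" "zero ?K = 0"
    by (simp_all add: type_ring_def)
  have h_alt: "h p = {j + p | j. j \<in> J}" for p
    by (auto simp: h_def a_r_coset_def' R_sel)
  \<comment> \<open>The key criterion: \<open>J\<close> consists of the polynomials whose
    coefficients vanish off \<open>U\<close>, so congruence means agreement off \<open>U\<close>.
    Injectivity of \<open>e\<close>, independence and spanning all reduce to it.\<close>
  have h_eq: "h p = h q \<longleftrightarrow> (\<forall>m. m \<notin> U \<longrightarrow> Poly_Mapping.lookup p m = Poly_Mapping.lookup q m)" for p q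
  proof
    assume "h p = h q"
    moreover have "0 \<in> J" by (simp add: J_def)
    ultimately have "p \<in> h q" by (force simp: h_alt)
    then obtain j where "j \<in> J" "p = j + q" by (auto simp: h_alt)
    then show "\<forall>m. m \<notin> U \<longrightarrow> Poly_Mapping.lookup p m = Poly_Mapping.lookup q m"
      by (auto simp: J_def lookup_add in_keys_iff)
  next
    assume "\<forall>m. m \<notin> U \<longrightarrow> Poly_Mapping.lookup p m = Poly_Mapping.lookup q m"
    then have "p - q \<in> J"
      by (auto simp: J_def in_keys_iff lookup_minus)
    then have "p \<in> h q"
      by (auto simp: h_alt intro!: exI[of _ "p - q"])
    then show "h p = h q"
      unfolding h_def using J.a_repr_independence'[of p q] by (simp add: R_sel)
  qed
  note hom = J.rcos_ring_hom
  \<comment> \<open>The following facts transport the operations of the quotient space to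
    polynomials along \<open>h\<close>.\<close>
  have carV: "carrier ?V = range h"
    by (auto simp: quotient_algebra_def ring.defs module.defs FactRing_def A_RCOSETS_def' h_def R_sel)
  have zeroV: "zero ?V = h 0"
    using J.a_coset_add_zero[of J]
    by (simp add: quotient_algebra_def ring.defs module.defs FactRing_def h_def R_sel)
  have addV: "h p \<oplus>\<^bsub>?V\<^esub> h q = h (p + q)" for p q
    using ring_hom_add[OF hom, of p q]
    by (simp add: quotient_algebra_def ring.defs module.defs h_def R_sel)
  have smultV: "c \<odot>\<^bsub>?V\<^esub> h p = h (Const c * p)" for c p
    using ring_hom_mult[OF hom, of "Const c" p]
    by (simp add: quotient_algebra_def ring.defs module.defs h_def R_sel)
  have sumV: "finsum ?V (\<lambda>i. h (f i)) A = h (sum f A)" if "finite A" for f and A :: "('n \<Rightarrow>\<^sub>0 nat) set"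
    using that by (induction A) (auto simp: zeroV addV carV)
  define e where "e m = h (Poly_Mapping.single m 1)" for m
  have inj_e: "inj_on e (- U)"
    by (rule inj_onI) (force simp: e_def h_eq lookup_single when_def split: if_splits)
  \<comment> \<open>A \<open>lincomb\<close> runs over a set of vectors; injectivity of
    \<open>e\<close> turns it into a sum over exponents, and the result is the class of an explicit
    polynomial.\<close>
  have lin: "V.lincomb a (e ` (- U)) = h (\<Sum>m\<in>- U. Poly_Mapping.single m (a (e m)))" for a
  proof -
    have "V.lincomb a (e ` (- U)) = finsum ?V (\<lambda>m. a (e m) \<odot>\<^bsub>?V\<^esub> e m) (- U)"
      unfolding V.lincomb_def
      by (rule V.finsum_reindex) (use inj_e in \<open>auto simp: e_def smultV carV\<close>)
    also have "\<dots> = finsum ?V (\<lambda>m. h (Poly_Mapping.single m (a (e m)))) (- U)"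
      by (simp add: e_def smultV Const_def mult_single)
    finally show ?thesis by (simp add: sumV fin)
  qed
  have lookup_lin: "Poly_Mapping.lookup (\<Sum>m\<in>- U. Poly_Mapping.single m (b m)) k = b k" if "k \<notin> U" for b k
    using that fin by (simp add: lookup_sum lookup_single when_def)
  have finB: "finite (e ` (- U))" using fin by simp
  have B_car: "e ` (- U) \<subseteq> carrier ?V" by (auto simp: carV e_def)
  have "V.lin_indpt (e ` (- U))"
    using finB B_car
  proof (rule V.finite_lin_indpt2)
    fix a assume "V.lincomb a (e ` (- U)) = \<zero>\<^bsub>?V\<^esub>"
    then show "\<forall>v\<in>e ` (- U). a v = \<zero>\<^bsub>?K\<^esub>"
      by (auto simp: lin zeroV h_eq K_sel lookup_lin)
  qed
  moreover have gen: "V.gen_set (e ` (- U))"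
  proof -
    have "h p \<in> V.span (e ` (- U))" for p
    proof -
      \<comment> \<open>Coefficients are indexed by basis vectors, so the inverse of
        \<open>e\<close> recovers the exponent whose coefficient in \<open>p\<close> is to be
        used.\<close>
      define a where "a v = Poly_Mapping.lookup p (the_inv_into (- U) e v)" for v
      have "V.lincomb a (e ` (- U)) = h p"
        by (simp add: lin h_eq lookup_lin a_def the_inv_into_f_f[OF inj_e])
      then show ?thesis
        unfolding V.finite_span[OF finB B_car] by (auto simp: K_sel)
    qed
    then show ?thesis
      using V.span_is_subset2[OF B_car] by (auto simp: carV)
  qed
  ultimately have "V.basis (e ` (- U))"
    using B_car unfolding V.basis_def by simp
  then show "V.dim = card (- U)"
    using V.dim_basis[OF finB] inj_e by (simp add: card_image)
  show "V.fin_dim"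
    unfolding V.fin_dim_def using finB B_car gen by blast
qed

section \<open>Divisibility of monomials and the ideal of the theorem\<close>

lemma Var_power: "Var i ^ k = Poly_Mapping.single (Poly_Mapping.single i k) (1::'k::comm_ring_1)"
  by (induction k) (simp_all add: Var_def mult_single flip: single_add)

text \<open>Divisibility by a power of a variable, written on exponents. The truncated difference is
  a true complement exactly when the inequality holds.\<close>

lemma single_add_decomp_iff:
  "(\<exists>d. k = Poly_Mapping.single i x + d) \<longleftrightarrow> x \<le> Poly_Mapping.lookup k i" for x :: nat
proof
  assume "x \<le> Poly_Mapping.lookup k i"
  then have "k = Poly_Mapping.single i x + (k - Poly_Mapping.single i x)"
    by (intro poly_mapping_eqI) (auto simp: lookup_add lookup_minus lookup_single when_def)
  then show "\<exists>d. k = Poly_Mapping.single i x + d" ..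
qed (auto simp: lookup_add)

text \<open>Distinctness of \<open>i\<close> and \<open>j\<close> matters: for equal indices the two
  exponents would add up, and divisibility would require \<open>x + y\<close>.\<close>

lemma single_add_single_decomp_iff:
  fixes x y :: nat
  assumes "i \<noteq> j"
  shows "(\<exists>d. k = Poly_Mapping.single i x + Poly_Mapping.single j y + d)
    \<longleftrightarrow> x \<le> Poly_Mapping.lookup k i \<and> y \<le> Poly_Mapping.lookup k j"
proof
  let ?m = "Poly_Mapping.single i x + Poly_Mapping.single j y"
  assume "x \<le> Poly_Mapping.lookup k i \<and> y \<le> Poly_Mapping.lookup k j"
  then have "k = ?m + (k - ?m)"
    using assms by (intro poly_mapping_eqI) (auto simp: lookup_add lookup_minus lookup_single when_def)
  then show "\<exists>d. k = ?m + d" ..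
qed (use assms in \<open>auto simp: lookup_add lookup_single\<close>)

theorem theorem2p2:
  fixes H :: "nat ^ 'n::{finite,linorder} ^ 'n::{finite,linorder}"
    and a :: "'n \<Rightarrow> nat" and b :: nat
  assumes "\<And>i. H $ i $ i = a i"
    and "\<And>i j. i \<noteq> j \<Longrightarrow> H $ i $ j = b"
    and "\<And>i. a i \<ge> b"
  shows "vectorspace.fin_dim type_ring
           (quotient_algebra (J_ideal H :: ('n, 'k::field) mpoly set)) \<and>
         int (vectorspace.dim type_ring
           (quotient_algebra (J_ideal H :: ('n, 'k) mpoly set)))
           = det (\<chi> i j. int (H $ i $ j))"
proof -
  \<comment> \<open>These are the exponents in the mixed generators. As \<open>b\<close> is at most
    \<open>a i\<close>, the truncated subtraction is exact and can be undone.\<close>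
  define c where "c i = a i - b" for i
  have a_eq: "a i = c i + b" for i
    using assms(3)[of i] by (simp add: c_def)
  define F where "F = {f. (\<forall>i. f i < c i + b) \<and> (\<forall>i j. i \<noteq> j \<longrightarrow> \<not> (c i \<le> f i \<and> c j \<le> f j))}"
  \<comment> \<open>\<open>M\<close> holds the exponents of the generators and \<open>U\<close>
    those of their multiples, so \<open>U\<close> will describe the monomials in the ideal and
    \<open>F\<close> the remaining ones.\<close>
  define M where "M = {Poly_Mapping.single t (c t + b) | t. True}
    \<union> {Poly_Mapping.single i (c i) + Poly_Mapping.single j (c j) | i j. i < j}"
  define U where "U = {m + d | m d. m \<in> M}"
  have exps: "H $ i $ i - H $ i $ j = c i" "H $ j $ j - H $ i $ j = c j" if "i < j" for i j
    using that assms(1) assms(2)[of i j] by (auto simp: c_def)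
  have gens: "{Var t ^ (H $ t $ t) | t. True} \<union>
      {Var i ^ (H $ i $ i - H $ i $ j) * Var j ^ (H $ j $ j - H $ i $ j) | i j. i < j}
      = (\<lambda>m. Poly_Mapping.single m (1::'k)) ` M"
    (is "?A \<union> ?B = _")
  proof -
    have "?A = (\<lambda>m. Poly_Mapping.single m 1) ` {Poly_Mapping.single t (c t + b) | t. True}"
      by (auto simp: Var_power assms(1) a_eq image_iff)
    moreover have "?B = {Poly_Mapping.single (Poly_Mapping.single i (c i) + Poly_Mapping.single j (c j)) 1 | i j. i < j}"
      by (intro Collect_cong ex_cong1 rev_conj_cong refl) (simp add: Var_power mult_single exps)
    moreover have "\<dots> = (\<lambda>m. Poly_Mapping.single m 1) `
        {Poly_Mapping.single i (c i) + Poly_Mapping.single j (c j) | i j. i < j}"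
      by blast
    ultimately show ?thesis
      unfolding M_def image_Un by (simp only:)
  qed
  have J_eq: "J_ideal H = {p :: ('n, 'k) mpoly. Poly_Mapping.keys p \<subseteq> U}"
    unfolding J_ideal_def gens genideal_monomials U_def ..
  have U: "k \<in> U \<longleftrightarrow> Poly_Mapping.lookup k \<notin> F" for k
  proof -
    have "k \<in> U \<longleftrightarrow> (\<exists>t d. k = Poly_Mapping.single t (c t + b) + d)
        \<or> (\<exists>i j. i < j \<and> (\<exists>d. k = Poly_Mapping.single i (c i) + Poly_Mapping.single j (c j) + d))"
      unfolding U_def M_def by blast
    also have "\<dots> \<longleftrightarrow> (\<exists>t. c t + b \<le> Poly_Mapping.lookup k t)
        \<or> (\<exists>i j. i < j \<and> c i \<le> Poly_Mapping.lookup k i \<and> c j \<le> Poly_Mapping.lookup k j)"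
      by (simp add: single_add_decomp_iff single_add_single_decomp_iff less_imp_neq cong: conj_cong)
    \<comment> \<open>The generators use pairs with \<open>i < j\<close>; the condition is
      symmetric, so distinct pairs suffice, as in \<open>F\<close>.\<close>
    also have "\<dots> \<longleftrightarrow> (\<exists>t. c t + b \<le> Poly_Mapping.lookup k t)
        \<or> (\<exists>i j. i \<noteq> j \<and> c i \<le> Poly_Mapping.lookup k i \<and> c j \<le> Poly_Mapping.lookup k j)"
      by (metis neq_iff)
    finally show ?thesis
      unfolding F_def by (simp add: not_less)
  qed
  \<comment> \<open>Over the finite index type every function has finite support, so the functions
    counted above are precisely the exponent vectors outside \<open>U\<close>.\<close>
  have F_image: "F = Poly_Mapping.lookup ` (- U)"
  proof (intro equalityI subsetI)
    fix f assume "f \<in> F"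
    moreover have f: "f = Poly_Mapping.lookup (Abs_poly_mapping f)"
      by (rule lookup_Abs_poly_mapping[symmetric]) simp
    ultimately have "Abs_poly_mapping f \<in> - U"
      by (simp add: U)
    with f show "f \<in> Poly_Mapping.lookup ` (- U)"
      by (rule image_eqI)
  qed (auto simp: U)
  have inj: "inj_on Poly_Mapping.lookup (- U)"
    by (auto intro: inj_onI)
  have fin: "finite (- U)"
    using card_box_at_most_one_large(1)[of c b] inj unfolding F_def[symmetric] F_image
    by (rule finite_imageD)
  have "int (card (- U)) = int (card F)"
    using inj by (simp add: F_image card_image)
  also have "\<dots> = (\<Prod>i\<in>UNIV. int (c i)) + int b * (\<Sum>k\<in>UNIV. \<Prod>i\<in>UNIV - {k}. int (c i))"
    unfolding F_def card_box_at_most_one_large(2) by simp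
  \<comment> \<open>The trivial membership in \<open>UNIV\<close> keeps the matrix in the shape of
    the determinant lemma with all rows carrying the constant.\<close>
  also have "\<dots> = det (\<chi> i j. (if i = j then int (c i) else 0) + (if i \<in> (UNIV :: 'n set) then int b else 0))"
    by (rule det_diagonal_plus_const_rows[symmetric])
  also have "(\<chi> i j. (if i = j then int (c i) else 0) + (if i \<in> (UNIV :: 'n set) then int b else 0))
      = (\<chi> i j. int (H $ i $ j))"
    using assms(1,2) by (auto simp: vec_eq_iff a_eq)
  finally have card: "int (card (- U)) = det (\<chi> i j. int (H $ i $ j))" .
  show ?thesis
    using monomial_quotient_dim[OF ideal_J_ideal[of H, where 'k = 'k, unfolded J_eq] fin] card
    unfolding J_eq by simp
qed

end
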